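(* Let $p$ be a prime and $s,t\in\mathbb{N}$. Let $b_1(X),\ldots,b_t(X)\in\mathbb{F}_p[X]$ be monic, nonconstant, pairwise coprime polynomials. Let $L_1,\ldots,L_s\in\mathbb{F}_p((X^{-1}))$ be such that $1,L_1,\ldots,L_s$ are linearly independent over $\mathbb{F}_p(X)$. Let $(\boldsymbol{x}_n)_{n\ge0}$ be the $s$-dimensional digital Kronecker sequence determined by $L_1,\ldots,L_s$, and let $(\boldsymbol{y}_n)_{n\ge0}$ be the $t$-dimensional Halton sequence in bases $b_1(X),\ldots,b_t(X)$. Then the $(s+t)$-dimensional hybrid sequence $((\boldsymbol{x}_n,\boldsymbol{y}_n))_{n\ge0}$ is uniformly distributed in $[0,1)^{s+t}$.
   Context: Elements of $\mathbb{F}_p$ are identified with the integers $\{0,1,\ldots,p-1\}$. For an integer $n\ge0$ with base-$p$ expansion $n=n_0+n_1p+\cdots+n_rp^r$, put $n(X)=n_0+n_1X+\cdots+n_rX^r\in\mathbb{F}_p[X]$. For $L=\sum_{i=w}^\infty a_iX^{-i}\in\mathbb{F}_p((X^{-1}))$ the fractional part is $\{L\}=\sum_{i\ge\max(1,w)}a_iX^{-i}$. Digital Kronecker sequence: for $L\in\mathbb{F}_p((X^{-1}))$ the one-dimensional sequence $(x_n)_{n\ge0}$ is defined by writing $\{n(X)L\}=\sum_{i\ge1}c_iX^{-i}$ and setting $x_n=\sum_{i\ge1}c_ip^{-i}$; the $s$-dimensional digital Kronecker sequence determined by $L_1,\ldots,L_s$ has $n$-th point $(x_n^{(1)},\ldots,x_n^{(s)})$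 where $x_n^{(i)}$ is the $n$-th point of the one-dimensional sequence for $L_i$. Van der Corput sequence in base $b(X)$ (monic, nonconstant, degree $e$): write $n(X)=\sum_{i\ge0}a_i(X)b(X)^i$ with $\deg a_i<e$ and set $y_n=\sum_{i\ge0}a_i(p)p^{-e(i+1)}$ (where $a_i(p)$ is the integer obtained by substituting $X=p$). The Halton sequence in bases $b_1(X),\ldots,b_t(X)$ has $n$-th point whose $j$-th coordinate is the $n$-th point of the van der Corput sequence in base $b_j(X)$. A sequence $(\boldsymbol z_n)$ in $[0,1)^d$ is uniformly distributed if $\lim_{N\to\infty}D_N=0$, where $D_N=\sup_B|A_N(B)/N-\lambda(B)|$, the supremum over all axis-parallel boxes $B\subseteq[0,1)^d$, $A_N(B)=\#\{0\le n<N:\boldsymbol z_n\in B\}$, $\lambda$ Lebesgue measure. *)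

theory Defs
  imports "HOL-Analysis.Analysis" "Berlekamp_Zassenhaus.Finite_Field"
    "HOL-Computational_Algebra.Polynomial"
begin

text \<open>F_p is the type 'p mod_ring with 'p of class prime_card, so p = CARD('p).
  An element of F_p((X^{-1})) is represented by its coefficient function
  L :: int => 'p mod_ring, where L i is the coefficient of X^{-i}; such a function
  is a Laurent series iff its support is bounded below (no positive powers of X
  beyond a finite order).\<close>

definition is_laurent :: "(int \<Rightarrow> 'a::zero) \<Rightarrow> bool" where
  "is_laurent L \<longleftrightarrow> (\<exists>w. \<forall>i<w. L i = 0)"

definition poly_times_laurent :: "'a::comm_semiring_1 poly \<Rightarrow> (int \<Rightarrow> 'a) \<Rightarrow> int \<Rightarrow> 'a" where
  "poly_times_laurent q L i = (\<Sum>k\<le>degree q. Polynomial.coeff q k * L (i + int k))"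

definition laurent_of_poly :: "'a::zero poly \<Rightarrow> int \<Rightarrow> 'a" where
  "laurent_of_poly q i = (if i \<le> 0 then Polynomial.coeff q (nat (- i)) else 0)"

text \<open>1, L_0, ..., L_{s-1} linearly independent over F_p(X) (equivalently, after clearing
  denominators, over F_p[X]).\<close>
definition lin_indep_1_laurent :: "nat \<Rightarrow> (nat \<Rightarrow> int \<Rightarrow> 'a::comm_semiring_1) \<Rightarrow> bool" where
  "lin_indep_1_laurent s L \<longleftrightarrow>
     (\<forall>q :: nat \<Rightarrow> 'a poly.
        (\<forall>i. laurent_of_poly (q 0) i + (\<Sum>j<s. poly_times_laurent (q (Suc j)) (L j) i) = 0)
        \<longrightarrow> (\<forall>j\<le>s. q j = 0))"

definition fp_val :: "'p::finite mod_ring \<Rightarrow> real" where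
  "fp_val c = real_of_int (to_int_mod_ring c)"

definition nat_poly :: "nat \<Rightarrow> 'p::prime_card mod_ring poly" where
  "nat_poly n = (\<Sum>j\<le>n. Polynomial.monom (of_nat (n div CARD('p) ^ j mod CARD('p))) j)"

definition kronecker_pt :: "(int \<Rightarrow> 'p::prime_card mod_ring) \<Rightarrow> nat \<Rightarrow> real" where
  "kronecker_pt L n =
     (\<Sum>i. fp_val (poly_times_laurent (nat_poly n :: 'p mod_ring poly) L (int i + 1))
            / real CARD('p) ^ (i + 1))"

definition eval_at_p :: "'p::prime_card mod_ring poly \<Rightarrow> real" where
  "eval_at_p a = (\<Sum>k\<le>degree a. fp_val (Polynomial.coeff a k) * real CARD('p) ^ k)"

definition vdc_pt :: "'p::prime_card mod_ring poly \<Rightarrow> nat \<Rightarrow> real" where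
  "vdc_pt b n =
     (\<Sum>i. eval_at_p ((nat_poly n div b ^ i) mod b) / real CARD('p) ^ (degree b * (i + 1)))"

definition discrepancy :: "nat \<Rightarrow> (nat \<Rightarrow> nat \<Rightarrow> real) \<Rightarrow> nat \<Rightarrow> real" where
  "discrepancy d z N =
     (SUP ab \<in> {(a, b). \<forall>j<d. 0 \<le> a j \<and> a j \<le> b j \<and> b j \<le> 1}.
        \<bar>real (card {n. n < N \<and> (\<forall>j<d. fst ab j \<le> z n j \<and> z n j < snd ab j)}) / real N
         - (\<Prod>j<d. snd ab j - fst ab j)\<bar>)"

definition uniformly_distributed :: "nat \<Rightarrow> (nat \<Rightarrow> nat \<Rightarrow> real) \<Rightarrow> bool" where
  "uniformly_distributed d z \<longleftrightarrow> (discrepancy d z \<longlonglongrightarrow> 0)"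

definition hybrid_pt :: "nat \<Rightarrow> (nat \<Rightarrow> int \<Rightarrow> 'p::prime_card mod_ring) \<Rightarrow>
     (nat \<Rightarrow> 'p mod_ring poly) \<Rightarrow> nat \<Rightarrow> nat \<Rightarrow> real" where
  "hybrid_pt s L b n j = (if j < s then kronecker_pt (L j) n else vdc_pt (b (j - s)) n)"

end

theory Submission
  imports Defs "Berlekamp_Zassenhaus.Chinese_Remainder_Poly"
begin

text \<open>
  Only finitely many digits matter: up to a small error every box is a union of cells on which the
  first \<open>l\<close> digits of all coordinates are prescribed. Agreement of these digits is preserved when
  both polynomials are translated by a third, so inside a block \<open>{q p\<^sup>M..<(q + 1) p\<^sup>M}\<close>, whose polynomials form a coset of
  the polynomials of degree less than \<open>M\<close>, all nonempty cells contain equally many \<open>n\<close>, provided \<open>M\<close>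
  is large enough for every cell to have a representative of degree less than \<open>M\<close>. So it remains to
  see that every combination of digits occurs. The Halton digits fix \<open>n(X)\<close> modulo
  \<open>B = \<Prod>\<^sub>j b\<^sub>j\<^sup>l\<close> by the Chinese remainder theorem, leaving \<open>n = R + k B\<close> with \<open>k\<close> free; the Kronecker
  digits of \<open>k B\<close> are linear functionals of \<open>k\<close>, and a linear dependence among them would exhibit
  a polynomial combination of the \<open>L\<^sub>j\<close> with vanishing fractional part.
\<close>

subsection \<open>Discrepancy and cells\<close>

text \<open>With q = N div C, both the count below N and N * K / C lie between q * K and (q + 1) *
  K, so for N > 0 the frequency differs from K / C by at most K / N.\<close>

lemma tendsto_density_of_block_count:
  fixes P :: "nat \<Rightarrow> bool" and C K :: nat
  assumes C: "C > 0" and K: "\<And>q. card {n. n div C = q \<and> P n} = K"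
  shows "(\<lambda>N. real (card {n. n < N \<and> P n}) / real N) \<longlonglongrightarrow> real K / real C"
proof -
  have less_iff: "n < q * C \<longleftrightarrow> n div C < q" for n q
    using C by (simp add: div_less_iff_less_mult)
  have blocks: "card {n. n < q * C \<and> P n} = q * K" for q
  proof (induction q)
    case (Suc q)
    have "{n. n < Suc q * C \<and> P n} = {n. n < q * C \<and> P n} \<union> {n. n div C = q \<and> P n}"
      by (auto simp: less_iff simp del: mult_Suc)
    moreover have "{n. n < q * C \<and> P n} \<inter> {n. n div C = q \<and> P n} = {}"
      by (auto simp: less_iff)
    moreover have "finite {n. n div C = q \<and> P n}"
      by (rule finite_subset[of _ "{..<Suc q * C}"]) (auto simp: less_iff simp del: mult_Suc)
    ultimately show ?case
      using Suc K[of q] by (simp add: card_Un_disjoint)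
  qed simp
  have bound: "\<bar>real (card {n. n < N \<and> P n}) / real N - real K / real C\<bar> \<le> real K / real N"
    if "N > 0" for N
  proof -
    let ?c = "card {n. n < N \<and> P n}" and ?q = "N div C"
    have "card {n. n < ?q * C \<and> P n} \<le> ?c"
      by (rule card_mono) (auto intro: less_le_trans)
    hence lo: "real ?q * real K \<le> real ?c"
      by (simp add: blocks flip: of_nat_mult)
    have "?c \<le> card {n. n < Suc ?q * C \<and> P n}"
      by (rule card_mono) (use C in \<open>auto intro: less_trans dividend_less_div_times\<close>)
    hence hi: "real ?c \<le> (real ?q + 1) * real K"
      unfolding blocks by (metis of_nat_Suc of_nat_le_iff of_nat_mult add.commute)
    have q: "real ?q \<le> real N / real C" "real N / real C \<le> real ?q + 1"
      using C dividend_less_div_times[of C N]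
      by (auto simp: field_simps simp flip: of_nat_mult of_nat_add)
    have "real N / real C * real K \<le> (real ?q + 1) * real K" "real ?q * real K \<le> real N / real C * real K"
      using q by (intro mult_right_mono; simp)+
    hence "\<bar>real ?c - real N / real C * real K\<bar> \<le> real K"
      using lo hi by (simp add: algebra_simps abs_le_iff)
    hence "\<bar>real ?c - real N / real C * real K\<bar> / real N \<le> real K / real N"
      by (simp add: divide_right_mono)
    moreover have "real ?c / real N - real K / real C = (real ?c - real N / real C * real K) / real N"
      using that by (simp add: diff_divide_distrib)
    ultimately show ?thesis by (simp only: abs_divide abs_of_nat)
  qed
  have "(\<lambda>N. real (card {n. n < N \<and> P n}) / real N - real K / real C) \<longlonglongrightarrow> 0"
  proof (rule Lim_null_comparison)
    show "\<forall>\<^sub>F N in sequentially. norm (real (card {n. n < N \<and> P n}) / real N - real K / real C)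
        \<le> real K / real N"
      using bound by (auto intro!: eventually_sequentiallyI[of 1])
    show "(\<lambda>N. real K / real N) \<longlonglongrightarrow> 0" by (rule lim_const_over_n)
  qed
  thus ?thesis by (simp add: LIM_zero_iff)
qed

text \<open>\<open>S\<close> collects the closed cells [v/P, (v+1)/P] that can meet [a, b),
  \<open>T\<close> those contained in it. Each is a run of consecutive v with ends obtained by
  rounding a * P and b * P; the 3 absorbs all roundings and off-by-ones.\<close>

lemma grid_cells_approx_interval:
  fixes P :: nat and a b :: real
  assumes P: "P > 0" and ab: "0 \<le> a" "a \<le> b" "b \<le> 1"
  defines "S \<equiv> {v. v < P \<and> a \<le> (real v + 1) / real P \<and> real v / real P < b}"
    and "T \<equiv> {v. v < P \<and> a \<le> real v / real P \<and> (real v + 1) / real P < b}"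
  shows "real (card S) / real P - (b - a) \<le> 3 / real P"
    and "(b - a) - real (card T) / real P \<le> 3 / real P"
proof -
  have Pa: "0 \<le> a * real P" and Pb: "a * real P \<le> b * real P"
    using ab by (auto intro!: mult_right_mono)
  have "S \<subseteq> {v. v < P \<and> a * real P \<le> real v + 1 \<and> real v < b * real P}"
    using P by (auto simp: S_def field_simps)
  \<comment> \<open>For a = 0 the lower end is -1, which \<open>nat\<close> raises to 0.\<close>
  also have "\<dots> \<subseteq> {nat (\<lceil>a * real P\<rceil> - 1)..<nat \<lceil>b * real P\<rceil>}"
    by auto linarith+
  finally have "card S \<le> card {nat (\<lceil>a * real P\<rceil> - 1)..<nat \<lceil>b * real P\<rceil>}"
    by (intro card_mono) auto
  hence "real (card S) \<le> b * real P - a * real P + 3"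
    using Pa Pb by (simp; linarith)
  hence "real (card S) / real P \<le> (b * real P - a * real P + 3) / real P"
    by (rule divide_right_mono) simp
  thus "real (card S) / real P - (b - a) \<le> 3 / real P"
    using P by (simp add: diff_divide_distrib add_divide_distrib)
  have bP: "b * real P \<le> real P"
    using ab P by (simp add: mult_le_cancel_right1)
  have "{nat \<lceil>a * real P\<rceil>..<nat (\<lceil>b * real P\<rceil> - 1)} \<subseteq>
      {v. v < P \<and> a * real P \<le> real v \<and> real v + 1 < b * real P}"
    using Pa bP by auto linarith+
  also have "\<dots> \<subseteq> T"
    using P by (auto simp: T_def field_simps)
  finally have "card {nat \<lceil>a * real P\<rceil>..<nat (\<lceil>b * real P\<rceil> - 1)} \<le> card T"
    by (intro card_mono) (auto simp: T_def)
  hence "b * real P - a * real P - 3 \<le> real (card T)"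
    using Pa Pb by (simp; linarith)
  hence "(b * real P - a * real P - 3) / real P \<le> real (card T) / real P"
    by (rule divide_right_mono) simp
  thus "(b - a) - real (card T) / real P \<le> 3 / real P"
    using P by (simp add: diff_divide_distrib)
qed

text \<open>Only x - y is bounded, not its absolute value. Replacing x by max x y does not decrease
  the product and makes each deviation from y at most e in absolute value, so the usual bound for
  products of factors in [0, 1] applies.\<close>

lemma prod_diff_le_sum_diff:
  fixes x y :: "'i \<Rightarrow> real"
  assumes "\<And>i. i \<in> I \<Longrightarrow> 0 \<le> x i \<and> x i \<le> 1" "\<And>i. i \<in> I \<Longrightarrow> 0 \<le> y i \<and> y i \<le> 1"
    "\<And>i. i \<in> I \<Longrightarrow> x i - y i \<le> e i" "\<And>i. i \<in> I \<Longrightarrow> 0 \<le> e i"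
  shows "prod x I - prod y I \<le> sum e I"
proof (cases "finite I")
  case True
  have "prod x I \<le> (\<Prod>i\<in>I. max (x i) (y i))"
    using assms by (intro prod_mono) auto
  hence "prod x I - prod y I \<le> norm ((\<Prod>i\<in>I. max (x i) (y i)) - prod y I)"
    by simp
  also have "\<dots> \<le> (\<Sum>i\<in>I. norm (max (x i) (y i) - y i))"
    using assms by (intro norm_prod_diff) (auto simp: max_def)
  also have "\<dots> \<le> sum e I"
    using assms by (intro sum_mono) (auto simp: max_def)
  finally show ?thesis .
qed auto

text \<open>A box is sandwiched between two unions of grid cells of nearly the same volume. The
  cells are closed on the right because a digit series with only maximal digits from some place on
  reaches the right end of its cell.\<close>

lemma uniformly_distributed_by_cells:
  fixes z :: "nat \<Rightarrow> nat \<Rightarrow> real" and d :: nat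
  assumes cells: "\<And>m::nat. m > 0 \<Longrightarrow> \<exists>P u. (\<forall>j<d. m \<le> P j) \<and>
      (\<forall>n. \<forall>j<d. u n j < P j \<and> real (u n j) / real (P j) \<le> z n j
         \<and> z n j \<le> (real (u n j) + 1) / real (P j)) \<and>
      (\<forall>v. (\<forall>j<d. v j < P j) \<longrightarrow>
         (\<lambda>N. real (card {n. n < N \<and> (\<forall>j<d. u n j = v j)}) / real N)
           \<longlonglongrightarrow> 1 / (\<Prod>j<d. real (P j)))"
  shows "uniformly_distributed d z"
  unfolding uniformly_distributed_def
proof (rule LIMSEQ_I)
  fix r :: real assume r: "r > 0"
  \<comment> \<open>A quarter of r is reserved for the cells at the boundary of a box (3 / P j per
    coordinate), another quarter for the deviations of the cell frequencies.\<close>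
  obtain m :: nat where m: "m > 0" "real d * (3 / real m) < r / 4"
  proof -
    obtain m :: nat where *: "12 * real d / r + 1 < real m"
      using reals_Archimedean2 by blast
    moreover have "0 \<le> 12 * real d / r" using r by simp
    ultimately have m: "m > 0" by linarith
    moreover have "12 * real d / r < real m" using * by linarith
    ultimately have "real d * (3 / real m) < r / 4"
      using r by (simp add: field_simps)
    with m show ?thesis by (rule that)
  qed
  obtain P u where P: "\<And>j. j < d \<Longrightarrow> m \<le> P j"
    and u: "\<And>n j. j < d \<Longrightarrow> u n j < P j"
      "\<And>n j. j < d \<Longrightarrow> real (u n j) / real (P j) \<le> z n j"
      "\<And>n j. j < d \<Longrightarrow> z n j \<le> (real (u n j) + 1) / real (P j)"
    and lim: "\<And>v. (\<forall>j<d. v j < P j) \<Longrightarrow>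
         (\<lambda>N. real (card {n. n < N \<and> (\<forall>j<d. u n j = v j)}) / real N)
           \<longlonglongrightarrow> 1 / (\<Prod>j<d. real (P j))"
    using cells[OF m(1)] by blast
  have P0: "P j > 0" if "j < d" for j using P[OF that] m by linarith
  \<comment> \<open>Extensional index vectors: there are finitely many, and distinct ones differ at
    some j < d, so no n belongs to two cells.\<close>
  define V where "V = PiE {..<d} (\<lambda>j. {..<P j})"
  define f where "f N v = real (card {n. n < N \<and> (\<forall>j<d. u n j = v j)}) / real N" for N v
  define w where "w = 1 / (\<Prod>j<d. real (P j))"
  have finV: "finite V" unfolding V_def by (intro finite_PiE) auto
  \<comment> \<open>Summing over all cells yields one N0 that serves every union of cells. It does
    not depend on the box, which is what the supremum in the discrepancy requires.\<close>
  have "(\<lambda>N. \<Sum>v\<in>V. \<bar>f N v - w\<bar>) \<longlonglongrightarrow> (\<Sum>v\<in>V. \<bar>w - w\<bar>)"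
  proof (intro tendsto_intros)
    fix v assume "v \<in> V"
    hence "\<forall>j<d. v j < P j" by (auto simp: V_def PiE_iff)
    from lim[OF this] show "(\<lambda>N. f N v) \<longlonglongrightarrow> w" unfolding f_def w_def .
  qed
  hence "\<forall>\<^sub>F N in sequentially. (\<Sum>v\<in>V. \<bar>f N v - w\<bar>) < r / 4"
    using r by (intro order_tendstoD(2)) auto
  then obtain N0 where N0: "\<And>N. N \<ge> N0 \<Longrightarrow> (\<Sum>v\<in>V. \<bar>f N v - w\<bar>) < r / 4"
    unfolding eventually_sequentially by blast
  have product: "\<bar>real (card {n. n < N \<and> (\<forall>j<d. u n j \<in> S j)}) / real N
      - (\<Prod>j<d. real (card (S j)) / real (P j))\<bar> < r / 4"
    if N: "N \<ge> N0" and S: "\<And>j. j < d \<Longrightarrow> S j \<subseteq> {..<P j}" for N S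
  proof -
    let ?W = "PiE {..<d} S"
    have WV: "?W \<subseteq> V" unfolding V_def using S by (intro PiE_mono) auto
    have eq: "{n. n < N \<and> (\<forall>j<d. u n j \<in> S j)} = (\<Union>v\<in>?W. {n. n < N \<and> (\<forall>j<d. u n j = v j)})"
      (is "?l = ?r")
    proof
      show "?l \<subseteq> ?r"
      proof
        fix n assume "n \<in> ?l"
        hence "n \<in> {k. k < N \<and> (\<forall>j<d. u k j = restrict (u n) {..<d} j)}" "restrict (u n) {..<d} \<in> ?W"
          by auto
        thus "n \<in> ?r" by (intro UN_I)
      qed
      show "?r \<subseteq> ?l" by (auto simp: PiE_iff)
    qed
    have "card ?r = (\<Sum>v\<in>?W. card {n. n < N \<and> (\<forall>j<d. u n j = v j)})"
    proof (rule card_UN_disjoint)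
      show "finite ?W" using WV finV finite_subset by blast
      show "\<forall>v\<in>?W. \<forall>v'\<in>?W. v \<noteq> v' \<longrightarrow> {n. n < N \<and> (\<forall>j<d. u n j = v j)} \<inter>
          {n. n < N \<and> (\<forall>j<d. u n j = v' j)} = {}"
      proof (intro ballI impI, rule ccontr)
        fix v v' assume v: "v \<in> ?W" "v' \<in> ?W" "v \<noteq> v'" and
          ne: "{n. n < N \<and> (\<forall>j<d. u n j = v j)} \<inter> {n. n < N \<and> (\<forall>j<d. u n j = v' j)} \<noteq> {}"
        from ne have "\<forall>j<d. v j = v' j" by auto
        with v show False by (auto intro: PiE_ext)
      qed
    qed auto
    hence cnt: "real (card ?l) / real N = (\<Sum>v\<in>?W. f N v)"
      unfolding eq f_def by (simp add: sum_divide_distrib)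
    have "(\<Prod>j<d. real (card (S j)) / real (P j)) = (\<Sum>v\<in>?W. w)"
      by (simp add: w_def card_PiE prod_dividef)
    hence "\<bar>real (card ?l) / real N - (\<Prod>j<d. real (card (S j)) / real (P j))\<bar>
        = \<bar>\<Sum>v\<in>?W. f N v - w\<bar>"
      by (simp only: cnt sum_subtractf)
    also have "\<dots> \<le> (\<Sum>v\<in>?W. \<bar>f N v - w\<bar>)" by (rule sum_abs)
    also have "\<dots> \<le> (\<Sum>v\<in>V. \<bar>f N v - w\<bar>)" by (rule sum_mono2[OF finV WV]) auto
    also have "\<dots> < r / 4" by (rule N0[OF N])
    finally show ?thesis .
  qed
  have sum3: "(\<Sum>j<d. 3 / real (P j)) < r / 4"
  proof -
    have "(\<Sum>j<d. 3 / real (P j)) \<le> (\<Sum>j<d. 3 / real m)"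
      using P m by (intro sum_mono divide_left_mono) (auto intro!: mult_pos_pos P0)
    also have "\<dots> < r / 4" using m by simp
    finally show ?thesis .
  qed
  have box: "\<bar>real (card {n. n < N \<and> (\<forall>j<d. a j \<le> z n j \<and> z n j < b j)}) / real N
      - (\<Prod>j<d. b j - a j)\<bar> \<le> r / 2" (is "\<bar>real (card ?B) / _ - _\<bar> \<le> _")
    if N: "N \<ge> N0" and ab: "\<And>j. j < d \<Longrightarrow> 0 \<le> a j \<and> a j \<le> b j \<and> b j \<le> 1" for N a b
  proof -
    \<comment> \<open>\<open>S\<close> gives an outer and \<open>T\<close> an inner approximation of
      the box by products of index sets, to which \<open>product\<close> applies.\<close>
    define S where "S j = {v. v < P j \<and> a j \<le> (real v + 1) / real (P j) \<and> real v / real (P j) < b j}" for j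
    define T where "T j = {v. v < P j \<and> a j \<le> real v / real (P j) \<and> (real v + 1) / real (P j) < b j}" for j
    have S: "S j \<subseteq> {..<P j}" and T: "T j \<subseteq> {..<P j}" for j by (auto simp: S_def T_def)
    have cS: "real (card (S j)) / real (P j) \<le> 1" and cT: "real (card (T j)) / real (P j) \<le> 1"
      if "j < d" for j
      using card_mono[OF _ S[of j]] card_mono[OF _ T[of j]] P0[OF that] by auto
    have ba: "0 \<le> b j - a j \<and> b j - a j \<le> 1" if "j < d" for j
      using ab[OF that] by linarith
    have "card ?B \<le> card {n. n < N \<and> (\<forall>j<d. u n j \<in> S j)}"
    proof (rule card_mono)
      show "?B \<subseteq> {n. n < N \<and> (\<forall>j<d. u n j \<in> S j)}"
        using u unfolding S_def by (fastforce intro: order_trans le_less_trans)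
    qed auto
    hence "real (card ?B) / real N \<le> real (card {n. n < N \<and> (\<forall>j<d. u n j \<in> S j)}) / real N"
      by (simp add: divide_right_mono)
    moreover have "(\<Prod>j<d. real (card (S j)) / real (P j)) - (\<Prod>j<d. b j - a j) \<le> (\<Sum>j<d. 3 / real (P j))"
      using ab ba cS grid_cells_approx_interval(1)[OF P0] unfolding S_def
      by (intro prod_diff_le_sum_diff) (auto intro: order_trans)
    ultimately have upper: "real (card ?B) / real N - (\<Prod>j<d. b j - a j) \<le> r / 2"
      using product[OF N S] sum3 unfolding abs_less_iff by linarith
    have "card {n. n < N \<and> (\<forall>j<d. u n j \<in> T j)} \<le> card ?B"
    proof (rule card_mono)
      show "{n. n < N \<and> (\<forall>j<d. u n j \<in> T j)} \<subseteq> ?B"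
        using u unfolding T_def by (fastforce intro: order_trans le_less_trans)
    qed auto
    hence "real (card {n. n < N \<and> (\<forall>j<d. u n j \<in> T j)}) / real N \<le> real (card ?B) / real N"
      by (simp add: divide_right_mono)
    moreover have "(\<Prod>j<d. b j - a j) - (\<Prod>j<d. real (card (T j)) / real (P j)) \<le> (\<Sum>j<d. 3 / real (P j))"
      using ab ba cT grid_cells_approx_interval(2)[OF P0] unfolding T_def
      by (intro prod_diff_le_sum_diff) (auto intro: order_trans)
    ultimately have "(\<Prod>j<d. b j - a j) - real (card ?B) / real N \<le> r / 2"
      using product[OF N T] sum3 unfolding abs_less_iff by linarith
    with upper show ?thesis unfolding abs_le_iff by linarith
  qed
  show "\<exists>no. \<forall>N\<ge>no. norm (discrepancy d z N - 0) < r"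
  proof (intro exI allI impI)
    fix N assume N: "N \<ge> N0"
    let ?I = "{(a, b). \<forall>j<d. 0 \<le> a j \<and> a j \<le> b j \<and> b j \<le> (1::real)}"
    let ?g = "\<lambda>ab. \<bar>real (card {n. n < N \<and> (\<forall>j<d. fst ab j \<le> z n j \<and> z n j < snd ab j)}) / real N
         - (\<Prod>j<d. snd ab j - fst ab j)\<bar>"
    have le: "?g ab \<le> r / 2" if "ab \<in> ?I" for ab
      by (rule box[OF N]) (use that in auto)
    \<comment> \<open>The unit cube shows that the family of boxes is nonempty; its own term, an
      absolute value, also bounds the supremum below by 0.\<close>
    have ne: "(\<lambda>_. 0, \<lambda>_. 1) \<in> ?I" by simp
    hence "?I \<noteq> {}" by (metis empty_iff)
    hence "discrepancy d z N \<le> r / 2"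
      unfolding discrepancy_def by (rule cSUP_least) (rule le)
    moreover have "0 \<le> discrepancy d z N"
      unfolding discrepancy_def
    proof (rule order_trans[OF _ cSUP_upper[OF ne]])
      show "bdd_above (?g ` ?I)" by (rule bdd_aboveI2[OF le])
    qed simp
    ultimately show "norm (discrepancy d z N - 0) < r" using r by simp
  qed
qed

subsection \<open>Digit expansions and the indexing of polynomials\<close>

text \<open>Most significant digit first: this is the numerator over Q^l of the expansion
  0.d(0)d(1)... in base Q cut after l digits.\<close>

primrec digit_val :: "nat \<Rightarrow> (nat \<Rightarrow> nat) \<Rightarrow> nat \<Rightarrow> nat" where
  "digit_val Q d 0 = 0"
| "digit_val Q d (Suc l) = digit_val Q d l * Q + d l"

lemma digit_val_less:
  assumes "\<And>i. d i < Q"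
  shows "digit_val Q d l < Q ^ l"
proof (induction l)
  case (Suc l)
  have "digit_val Q d l * Q + d l < (digit_val Q d l + 1) * Q"
    using assms[of l] by simp
  also have "\<dots> \<le> Q ^ l * Q"
    using Suc by (intro mult_right_mono) auto
  finally show ?case by (simp add: mult.commute)
qed simp

lemma digit_val_eq_iff:
  assumes "\<And>i. d i < Q" "\<And>i. d' i < Q"
  shows "digit_val Q d l = digit_val Q d' l \<longleftrightarrow> (\<forall>i<l. d i = d' i)"
proof (induction l)
  case (Suc l)
  have "x * Q + d l = y * Q + d' l \<longleftrightarrow> x = y \<and> d l = d' l" for x y
  proof
    assume eq: "x * Q + d l = y * Q + d' l"
    hence "(x * Q + d l) div Q = (y * Q + d' l) div Q" by simp
    moreover have "Q > 0" using assms(1)[of l] by simp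
    ultimately have "x = y" using assms[of l] by simp
    with eq show "x = y \<and> d l = d' l" by simp
  qed simp
  with Suc show ?case by (auto simp: less_Suc_eq)
qed simp

lemma digit_val_surj:
  assumes "v < Q ^ l" "Q > 0"
  shows "\<exists>d. (\<forall>i. d i < Q) \<and> digit_val Q d l = v"
  using assms(1)
proof (induction l arbitrary: v)
  case 0
  thus ?case using assms(2) by (auto intro!: exI[of _ "\<lambda>_. 0"])
next
  case (Suc l)
  have "v div Q < Q ^ l"
    using Suc.prems by (simp add: less_mult_imp_div_less mult.commute)
  then obtain d where d: "\<forall>i. d i < Q" "digit_val Q d l = v div Q"
    using Suc.IH by blast
  let ?d = "d(l := v mod Q)"
  have "digit_val Q ?d l = digit_val Q d l"
    using d assms(2) by (subst digit_val_eq_iff) auto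
  hence "(\<forall>i. ?d i < Q) \<and> digit_val Q ?d (Suc l) = v"
    using d assms(2) by simp
  thus ?case by blast
qed

text \<open>The tail after l digits is at least 0 and at most the tail \<open>?g\<close> with all
  digits Q - 1, a geometric series with sum 1 / Q^l. The upper bound can be attained.\<close>

lemma digit_val_bounds:
  assumes d: "\<And>i. d i < Q" and Q: "Q > 1"
  defines "z \<equiv> \<Sum>i. real (d i) / real Q ^ (i + 1)"
  shows "real (digit_val Q d l) / real Q ^ l \<le> z" and "z \<le> (real (digit_val Q d l) + 1) / real Q ^ l"
proof -
  let ?f = "\<lambda>i. real (d i) / real Q ^ (i + 1)" and ?g = "\<lambda>i. (real Q - 1) / real Q ^ (i + 1)"
  have fg: "?f i \<le> ?g i" for i
    using d[of i] Q by (intro divide_right_mono) auto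
  have "(\<lambda>i. (1 / real Q) ^ i) sums (1 / (1 - 1 / real Q))"
    using Q by (intro geometric_sums) simp
  note geom = sums_mult[OF this, of "(real Q - 1) / (real Q * real Q ^ l)" for l]
  have "(real Q - 1) / (real Q * real Q ^ l) * (1 / real Q) ^ i = ?g (i + l)" for i l
    by (simp add: power_add power_one_over field_simps)
  moreover have "(real Q - 1) / (real Q * real Q ^ l) * (1 / (1 - 1 / real Q)) = 1 / real Q ^ l" for l
    using Q by (simp add: divide_simps)
  ultimately have g: "(\<lambda>i. ?g (i + l)) sums (1 / real Q ^ l)" for l
    using geom[of l] by simp
  have sumg: "summable ?g" using g[of 0] by (simp add: sums_iff)
  have sumf: "summable ?f"
    by (rule summable_comparison_test'[OF sumg, of 0]) (use fg in simp)
  have part: "(\<Sum>i<l. ?f i) = real (digit_val Q d l) / real Q ^ l"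
    using Q by (induction l) (simp_all add: field_simps)
  have z: "z = (\<Sum>i. ?f (i + l)) + real (digit_val Q d l) / real Q ^ l"
    unfolding z_def part[symmetric] by (rule suminf_split_initial_segment[OF sumf])
  have sumfl: "summable (\<lambda>i. ?f (i + l))"
    using sumf by (subst summable_iff_shift)
  have "0 \<le> (\<Sum>i. ?f (i + l))"
    by (intro suminf_nonneg sumfl) simp
  thus "real (digit_val Q d l) / real Q ^ l \<le> z" by (simp add: z)
  have "(\<Sum>i. ?f (i + l)) \<le> (\<Sum>i. ?g (i + l))"
    using g[of l] by (intro suminf_le fg sumfl) (simp add: sums_iff)
  also have "\<dots> = 1 / real Q ^ l" using g[of l] by (simp add: sums_iff)
  finally show "z \<le> (real (digit_val Q d l) + 1) / real Q ^ l"
    by (simp add: z add_divide_distrib)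
qed

section \<open>Polynomials over F_p and their integer indices\<close>

abbreviation digit :: "'p::prime_card mod_ring \<Rightarrow> nat" where
  "digit c \<equiv> nat (to_int_mod_ring c)"

lemma to_int_mod_ring_bounds:
  fixes c :: "'p::prime_card mod_ring"
  shows "0 \<le> to_int_mod_ring c" "to_int_mod_ring c < int CARD('p)"
  using range_to_int_mod_ring[where 'a = 'p] by auto

lemma digit_less: "digit (c :: 'p::prime_card mod_ring) < CARD('p)"
  using to_int_mod_ring_bounds[of c] by linarith

lemma of_nat_digit [simp]: "of_nat (digit c) = (c :: 'p::prime_card mod_ring)"
  using to_int_mod_ring_bounds[of c] by (simp add: of_nat_of_int_mod_ring)

lemma digit_of_nat: "k < CARD('p) \<Longrightarrow> digit (of_nat k :: 'p::prime_card mod_ring) = k"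
  by (simp add: of_nat_of_int_mod_ring)

lemma CARD_prime_card_gt_1: "CARD('p::prime_card) > 1"
  using prime_card prime_gt_1_nat by blast

lemma coeff_nat_poly:
  "Polynomial.coeff (nat_poly n :: 'p::prime_card mod_ring poly) k =
     of_nat (n div CARD('p) ^ k mod CARD('p))"
proof -
  \<comment> \<open>The sum defining \<open>nat_poly n\<close> stops at exponent n; no digit is
    lost, since n < k < p^k.\<close>
  have "n div CARD('p) ^ k = 0" if "n < k"
  proof -
    have "k < CARD('p) ^ k" by (rule power_gt_expt[OF CARD_prime_card_gt_1[unfolded One_nat_def]])
    thus ?thesis using that by simp
  qed
  thus ?thesis
    by (auto simp: nat_poly_def Polynomial.coeff_sum if_distrib cong: if_cong)
qed

lemma nat_poly_add_mult:
  assumes "c < CARD('p)"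
  shows "nat_poly (c + CARD('p) * n) =
    (pCons (of_nat c) (nat_poly n) :: 'p::prime_card mod_ring poly)"
proof (rule Polynomial.poly_eqI)
  fix k
  show "Polynomial.coeff (nat_poly (c + CARD('p) * n)) k =
    Polynomial.coeff (pCons (of_nat c) (nat_poly n) :: 'p mod_ring poly) k"
    using assms by (cases k) (simp_all add: coeff_nat_poly Polynomial.coeff_pCons div_mult2_eq)
qed

text \<open>The inverse of \<open>nat_poly\<close>, given by substituting X = p after lifting the
  coefficients to {0..p-1}.\<close>

definition poly_index :: "'p::prime_card mod_ring poly \<Rightarrow> nat" where
  "poly_index f = (\<Sum>k\<le>degree f. digit (Polynomial.coeff f k) * CARD('p) ^ k)"

lemma eval_at_p_eq_poly_index: "eval_at_p f = real (poly_index f)"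
  by (simp add: eval_at_p_def poly_index_def fp_val_def to_int_mod_ring_bounds)

lemma poly_index_0 [simp]: "poly_index 0 = 0"
  by (simp add: poly_index_def)

lemma poly_index_pCons:
  "poly_index (pCons c f :: 'p::prime_card mod_ring poly) = digit c + CARD('p) * poly_index f"
  by (cases "f = 0")
    (simp_all add: poly_index_def sum.atMost_Suc_shift sum_distrib_left mult_ac del: sum.atMost_Suc)

lemma nat_poly_0 [simp]: "nat_poly 0 = (0 :: 'p::prime_card mod_ring poly)"
  by (rule Polynomial.poly_eqI) (simp add: coeff_nat_poly)

lemma nat_poly_poly_index [simp]: "nat_poly (poly_index f) = (f :: 'p::prime_card mod_ring poly)"
  by (induction f) (simp_all add: poly_index_pCons nat_poly_add_mult digit_less)

lemma poly_index_nat_poly [simp]: "poly_index (nat_poly n :: 'p::prime_card mod_ring poly) = n"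
proof (induction n rule: less_induct)
  case (less n)
  show ?case
  proof (cases "n = 0")
    case False
    let ?p = "CARD('p)"
    have "nat_poly n = (pCons (of_nat (n mod ?p)) (nat_poly (n div ?p)) :: 'p mod_ring poly)"
      using nat_poly_add_mult[of "n mod ?p" "n div ?p", where 'p = 'p] by simp
    moreover have "n div ?p < n" using False CARD_prime_card_gt_1[where 'p = 'p] by simp
    ultimately show ?thesis
      using less by (simp add: poly_index_pCons digit_of_nat)
  qed simp
qed

lemma poly_index_less_power:
  fixes f :: "'p::prime_card mod_ring poly"
  assumes "\<And>k. k \<ge> e \<Longrightarrow> Polynomial.coeff f k = 0"
  shows "poly_index f < CARD('p) ^ e"
  using assms
proof (induction e arbitrary: f)
  case 0
  hence "f = 0" by (intro Polynomial.poly_eqI) simp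
  thus ?case by simp
next
  case (Suc e)
  obtain c g where f: "f = pCons c g" by (cases f)
  have "poly_index g < CARD('p) ^ e"
    using Suc.prems[of "Suc k" for k] by (intro Suc.IH) (simp add: f)
  hence le: "poly_index g + 1 \<le> CARD('p) ^ e" by simp
  have "poly_index f < CARD('p) * (poly_index g + 1)"
    using digit_less[of c] by (simp add: f poly_index_pCons)
  also have "\<dots> \<le> CARD('p) * CARD('p) ^ e"
    by (rule mult_left_mono[OF le]) simp
  finally show ?case by simp
qed

lemma degree_nat_poly_less:
  assumes "n < CARD('p) ^ e" "e > 0"
  shows "degree (nat_poly n :: 'p::prime_card mod_ring poly) < e"
proof -
  have "n div CARD('p) ^ k = 0" if "k \<ge> e" for k
    using less_le_trans[OF assms(1) power_increasing[OF that]] by simp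
  hence "degree (nat_poly n :: 'p mod_ring poly) \<le> e - 1"
    by (intro degree_le) (simp add: coeff_nat_poly)
  thus ?thesis using assms(2) by simp
qed

text \<open>Describes a block of p^M consecutive integers as a coset: the coefficients from X^M on
  are fixed. Adding a polynomial of degree less than M therefore stays in the block.\<close>

lemma div_CARD_power_eq_iff:
  "n div CARD('p) ^ M = q \<longleftrightarrow>
    (\<forall>k. Polynomial.coeff (nat_poly n :: 'p::prime_card mod_ring poly) (k + M) =
         Polynomial.coeff (nat_poly q) k)"
proof -
  have "Polynomial.coeff (nat_poly n :: 'p mod_ring poly) (k + M) =
      Polynomial.coeff (nat_poly (n div CARD('p) ^ M)) k" for k
    by (simp add: coeff_nat_poly power_add div_mult2_eq mult.commute)
  hence "(\<forall>k. Polynomial.coeff (nat_poly n :: 'p mod_ring poly) (k + M) =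
         Polynomial.coeff (nat_poly q) k) \<longleftrightarrow>
      nat_poly (n div CARD('p) ^ M) = (nat_poly q :: 'p mod_ring poly)"
    by (simp add: Polynomial.poly_eq_iff)
  thus ?thesis using poly_index_nat_poly[where 'p = 'p] by metis
qed

subsection \<open>Surjectivity of the digit maps\<close>

text \<open>Induction on I. It suffices to find y on which the functionals of I vanish but the new
  one does not; a solution for I is then corrected along y.\<close>

lemma (in vector_space) independent_functionals_interpolate:
  fixes \<phi> :: "'i \<Rightarrow> 'b \<Rightarrow> 'a"
  assumes "finite I"
    and "\<And>i. i \<in> I \<Longrightarrow> module_hom scale (*) (\<phi> i)"
    and "\<And>\<alpha>. (\<And>x. (\<Sum>i\<in>I. \<alpha> i * \<phi> i x) = 0) \<Longrightarrow> \<forall>i\<in>I. \<alpha> i = 0"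
  shows "\<exists>x. \<forall>i\<in>I. \<phi> i x = \<tau> i"
  using assms
proof (induction I arbitrary: \<tau> rule: finite_induct)
  case (insert a I)
  have "\<forall>i\<in>I. \<alpha> i = 0" if "\<And>x. (\<Sum>i\<in>I. \<alpha> i * \<phi> i x) = 0" for \<alpha>
  proof -
    let ?\<alpha> = "\<alpha>(a := 0)"
    have "(\<Sum>i\<in>I. ?\<alpha> i * \<phi> i x) = (\<Sum>i\<in>I. \<alpha> i * \<phi> i x)" for x
      using insert.hyps by (intro sum.cong) auto
    hence "(\<Sum>i\<in>insert a I. ?\<alpha> i * \<phi> i x) = 0" for x
      using insert.hyps that by simp
    from insert.prems(2)[OF this] show ?thesis
      using insert.hyps by (auto split: if_splits)
  qed
  hence IH: "\<exists>x. \<forall>i\<in>I. \<phi> i x = \<sigma> i" for \<sigma>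
    using insert.IH insert.prems(1) by blast
  have hom: "module_hom scale (*) (\<phi> i)" if "i \<in> insert a I" for i
    using insert.prems(1) that .
  \<comment> \<open>Vectors dual to the functionals of I, obtained from the induction hypothesis
    with 0/1 targets.\<close>
  have "\<exists>k. \<forall>i. \<forall>j\<in>I. \<phi> j (k i) = (if j = i then 1 else 0)"
    by (intro choice allI IH)
  then obtain k where k: "\<And>i j. j \<in> I \<Longrightarrow> \<phi> j (k i) = (if j = i then 1 else 0)"
    by blast
  \<comment> \<open>With these coefficients the combination at x equals \<phi> a y for the y defined
    below. The coefficient 1 at a makes the combination nontrivial, so independence provides an x
    where it is nonzero.\<close>
  let ?\<alpha> = "\<lambda>i. if i = a then 1 else - \<phi> a (k i)"
  obtain x where x: "(\<Sum>i\<in>insert a I. ?\<alpha> i * \<phi> i x) \<noteq> 0"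
    using insert.prems(2)[of ?\<alpha>] by auto
  \<comment> \<open>Subtracting the expansion of x in the dual vectors makes every functional of I
    vanish.\<close>
  define y where "y = x - (\<Sum>i\<in>I. scale (\<phi> i x) (k i))"
  have \<phi>y: "\<phi> j y = \<phi> j x - (\<Sum>i\<in>I. \<phi> i x * \<phi> j (k i))" if "j \<in> insert a I" for j
    using hom[OF that] by (simp add: y_def module_hom.diff module_hom.sum module_hom.scale)
  have yI: "\<phi> j y = 0" if "j \<in> I" for j
    using that insert.hyps \<phi>y[of j] by (simp add: k if_distrib cong: if_cong)
  have "(\<Sum>i\<in>I. ?\<alpha> i * \<phi> i x) = (\<Sum>i\<in>I. - (\<phi> i x * \<phi> a (k i)))"
    using insert.hyps by (intro sum.cong) auto
  hence "\<phi> a y = (\<Sum>i\<in>insert a I. ?\<alpha> i * \<phi> i x)"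
    using insert.hyps \<phi>y[of a] by (simp add: sum_negf)
  hence ya: "\<phi> a y \<noteq> 0" using x by simp
  obtain x0 where x0: "\<And>i. i \<in> I \<Longrightarrow> \<phi> i x0 = \<tau> i" using IH by blast
  let ?z = "x0 + scale ((\<tau> a - \<phi> a x0) / \<phi> a y) y"
  have "\<phi> i ?z = \<phi> i x0 + (\<tau> a - \<phi> a x0) / \<phi> a y * \<phi> i y" if "i \<in> insert a I" for i
    using hom[OF that] by (simp add: module_hom.add module_hom.scale)
  hence "\<forall>i\<in>insert a I. \<phi> i ?z = \<tau> i"
    using ya yI x0 by auto
  thus ?case by blast
qed simp

section \<open>Polynomial multiples of Laurent series\<close>

lemma poly_times_laurent_0 [simp]: "poly_times_laurent 0 L i = 0"
  by (simp add: poly_times_laurent_def)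

lemma poly_times_laurent_pCons:
  "poly_times_laurent (pCons a q) L i = a * L i + poly_times_laurent q L (i + 1)"
  by (cases "q = 0")
    (simp_all add: poly_times_laurent_def sum.atMost_Suc_shift add_ac del: sum.atMost_Suc)

lemma poly_times_laurent_add:
  "poly_times_laurent (q + r) L i = poly_times_laurent q L i + poly_times_laurent r L i"
  by (induction q r arbitrary: i rule: poly_induct2)
    (simp_all add: poly_times_laurent_pCons algebra_simps)

lemma poly_times_laurent_smult:
  "poly_times_laurent (Polynomial.smult c q) L i = c * poly_times_laurent q L i"
  by (induction q arbitrary: i) (simp_all add: poly_times_laurent_pCons algebra_simps)

lemma poly_times_laurent_sum:
  "poly_times_laurent (sum q A) L i = (\<Sum>a\<in>A. poly_times_laurent (q a) L i)"
  by (induction A rule: infinite_finite_induct) (simp_all add: poly_times_laurent_add)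

lemma poly_times_laurent_mult:
  "poly_times_laurent (q * r) L i = poly_times_laurent q (poly_times_laurent r L) i"
  by (induction q arbitrary: i)
    (simp_all add: poly_times_laurent_pCons poly_times_laurent_add poly_times_laurent_smult)

lemma poly_times_laurent_monom:
  "poly_times_laurent (Polynomial.monom c n) L i = c * L (i + int n)"
  by (induction n arbitrary: i)
    (simp_all add: Polynomial.monom_0 Polynomial.monom_Suc poly_times_laurent_pCons add_ac)

lemma is_laurent_poly_times_laurent:
  assumes "is_laurent L"
  shows "is_laurent (poly_times_laurent q L)"
proof -
  obtain w where "\<forall>i<w. L i = 0" using assms by (auto simp: is_laurent_def)
  hence "\<forall>i<w - int (degree q). poly_times_laurent q L i = 0"
    by (auto simp: poly_times_laurent_def intro!: sum.neutral)
  thus ?thesis unfolding is_laurent_def by blast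
qed

lemma is_laurent_sum:
  assumes "\<And>a. a \<in> A \<Longrightarrow> is_laurent (f a)"
  shows "is_laurent (\<lambda>i. \<Sum>a\<in>A. f a i)"
  using assms
proof (induction A rule: infinite_finite_induct)
  case (insert a A)
  then obtain w' where w': "\<forall>i<w'. (\<Sum>a\<in>A. f a i) = 0"
    by (auto simp: is_laurent_def)
  obtain w where "\<forall>i<w. f a i = 0"
    using insert.prems[of a] by (auto simp: is_laurent_def)
  hence "\<forall>i<min w w'. (\<Sum>a\<in>insert a A. f a i) = 0"
    using insert.hyps w' by simp
  thus ?case unfolding is_laurent_def by blast
qed (simp_all add: is_laurent_def)

lemma laurent_without_fractional_part_is_poly:
  fixes S :: "int \<Rightarrow> 'a::zero"
  assumes "is_laurent S" "\<And>i. i > 0 \<Longrightarrow> S i = 0"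
  shows "\<exists>q. laurent_of_poly q = S"
proof -
  obtain w where w: "\<forall>i<w. S i = 0" using assms(1) by (auto simp: is_laurent_def)
  let ?c = "\<lambda>n. S (- int n)"
  have c: "Polynomial.coeff (Abs_poly ?c) = ?c"
    by (rule Polynomial.coeff_Abs_poly[of "nat (- w)"]) (use w in auto)
  have "laurent_of_poly (Abs_poly ?c) i = S i" for i
    unfolding laurent_of_poly_def c using assms(2) by auto
  thus ?thesis by blast
qed

text \<open>A linear relation between the coefficients of \<open>k B L\<^sub>j\<close>, valid for \<open>k = X\<^sup>h\<close> with all \<open>h\<close>,
  says that a polynomial combination of the \<open>L\<^sub>j\<close> has vanishing fractional part.\<close>
lemma fractional_digit_functionals_independent:
  fixes L :: "nat \<Rightarrow> int \<Rightarrow> 'a::field" and \<alpha> :: "nat \<times> nat \<Rightarrow> 'a"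
  assumes laurent: "\<And>j. j < s \<Longrightarrow> is_laurent (L j)" and indep: "lin_indep_1_laurent s L"
    and B: "B \<noteq> 0"
    and rel: "\<And>k. (\<Sum>(j, i)\<in>{..<s} \<times> {..<m}.
      \<alpha> (j, i) * poly_times_laurent (k * B) (L j) (int i + 1)) = 0"
  shows "\<forall>ji\<in>{..<s} \<times> {..<m}. \<alpha> ji = 0"
proof -
  \<comment> \<open>The exponent is i + 1 because fractional digits start at X^(-1): multiplying by
    X^(i+1) moves the coefficient at index h + i + 1 to index h, so the relation for k = X^h says
    exactly that S vanishes at h.\<close>
  define A where "A j = (\<Sum>i<m. Polynomial.monom (\<alpha> (j, i)) (i + 1))" for j
  define S where "S x = (\<Sum>j<s. poly_times_laurent (A j * B) (L j) x)" for x
  have S_eq: "S x = (\<Sum>j<s. \<Sum>i<m. \<alpha> (j, i) * poly_times_laurent B (L j) (x + int i + 1))" for x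
    by (simp add: S_def A_def poly_times_laurent_mult poly_times_laurent_sum
        poly_times_laurent_monom add_ac)
  have "S (int h) = 0" for h
    using rel[of "Polynomial.monom 1 h"]
    by (simp add: S_eq poly_times_laurent_mult poly_times_laurent_monom sum.cartesian_product add_ac)
  hence Spos: "S x = 0" if "x > 0" for x
    using that by (metis zero_less_imp_eq_int)
  have "is_laurent S"
    unfolding S_def by (intro is_laurent_sum is_laurent_poly_times_laurent laurent) simp
  hence "is_laurent (\<lambda>x. - S x)" by (simp add: is_laurent_def)
  then obtain q0 where q0: "laurent_of_poly q0 = (\<lambda>x. - S x)"
    using laurent_without_fractional_part_is_poly[of "\<lambda>x. - S x"] Spos by auto
  \<comment> \<open>S is a polynomial, so q0 = -S turns its definition into a relation between 1 and
    the L j with coefficients A j * B. Independence gives A j * B = 0, and B is nonzero.\<close>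
  define q where "q j = (case j of 0 \<Rightarrow> q0 | Suc j \<Rightarrow> A j * B)" for j
  have "\<forall>i. laurent_of_poly (q 0) i + (\<Sum>j<s. poly_times_laurent (q (Suc j)) (L j) i) = 0"
    by (simp add: q_def q0 S_def)
  hence "\<forall>j\<le>s. q j = 0"
    by (rule indep[unfolded lin_indep_1_laurent_def, THEN spec, THEN mp])
  hence A0: "A j = 0" if "j < s" for j
    using that B by (auto simp: q_def dest!: spec[of _ "Suc j"])
  have "\<alpha> (j, i) = Polynomial.coeff (A j) (i + 1)" if "i < m" for i j
    using that by (simp add: A_def Polynomial.coeff_sum)
  thus ?thesis using A0 by auto
qed

lemma vector_space_poly_smult: "vector_space (Polynomial.smult :: 'a::field \<Rightarrow> _)"
  by unfold_locales (simp_all add: Polynomial.smult_add_right Polynomial.smult_add_left)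

text \<open>The digits are linear functionals of k on the space of polynomials, independent by the
  preceding lemma, so they take arbitrary values simultaneously. The fixed factor B leaves room for
  congruence conditions modulo B.\<close>

lemma fractional_digits_interpolate:
  fixes L :: "nat \<Rightarrow> int \<Rightarrow> 'a::field" and \<tau> :: "nat \<Rightarrow> nat \<Rightarrow> 'a"
  assumes "\<And>j. j < s \<Longrightarrow> is_laurent (L j)" "lin_indep_1_laurent s L" "B \<noteq> 0"
  shows "\<exists>k. \<forall>j<s. \<forall>i<m. poly_times_laurent (k * B) (L j) (int i + 1) = \<tau> j i"
proof -
  interpret vector_space "Polynomial.smult :: 'a \<Rightarrow> _" by (rule vector_space_poly_smult)
  let ?\<phi> = "\<lambda>(j, i) k. poly_times_laurent (k * B) (L j) (int i + 1)"
  have "\<exists>k. \<forall>ji\<in>{..<s} \<times> {..<m}. ?\<phi> ji k = (case ji of (j, i) \<Rightarrow> \<tau> j i)"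
  proof (rule independent_functionals_interpolate)
    fix \<alpha> :: "nat \<times> nat \<Rightarrow> 'a"
    assume rel: "(\<Sum>ji\<in>{..<s} \<times> {..<m}. \<alpha> ji * ?\<phi> ji k) = 0" for k
    have "(\<Sum>(j, i)\<in>{..<s} \<times> {..<m}.
        \<alpha> (j, i) * poly_times_laurent (k * B) (L j) (int i + 1)) = 0" for k
      using rel[of k] by (simp add: case_prod_unfold)
    thus "\<forall>ji\<in>{..<s} \<times> {..<m}. \<alpha> ji = 0"
      by (intro fractional_digit_functionals_independent[OF assms])
  qed (auto intro!: module_hom.intro module_hom_axioms.intro module_axioms
      simp: Modules.module_def distrib_left distrib_right poly_times_laurent_add poly_times_laurent_smult)
  thus ?thesis by auto
qed

section \<open>Expansions in a polynomial base\<close>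

text \<open>The residue modulo b^(l+1) is b^l times digit l plus the residue modulo b^l. Hence
  conditions on digits become congruences, which are stable under translation and open to the
  Chinese remainder theorem.\<close>

lemma poly_base_expansion_eq_iff:
  fixes b f g :: "'a::field poly"
  assumes "b \<noteq> 0"
  shows "(\<forall>i<l. (f div b ^ i) mod b = (g div b ^ i) mod b) \<longleftrightarrow> f mod b ^ l = g mod b ^ l"
proof (induction l)
  case (Suc l)
  have mod_Suc: "h mod b ^ Suc l = b ^ l * ((h div b ^ l) mod b) + h mod b ^ l" for h
    using poly_mod_mult_right[of h "b ^ l" b] by (simp add: mult.commute)
  have "f mod b ^ Suc l = g mod b ^ Suc l \<Longrightarrow> f mod b ^ l = g mod b ^ l"
    by (metis dvd_triv_right mod_mod_cancel power_Suc)
  thus ?case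
    using assms Suc unfolding mod_Suc by (auto simp: less_Suc_eq)
qed simp

lemma poly_base_expansion_exists:
  fixes b :: "'a::field poly" and a :: "nat \<Rightarrow> 'a poly"
  assumes "\<And>i. degree (a i) < degree b"
  shows "\<exists>f. \<forall>i<l. (f div b ^ i) mod b = a i"
  using assms
proof (induction l arbitrary: a)
  case (Suc l)
  then obtain g where g: "\<And>i. i < l \<Longrightarrow> (g div b ^ i) mod b = a (Suc i)"
    by (metis Suc.IH[of "\<lambda>i. a (Suc i)"])
  have b: "b \<noteq> 0" using Suc.prems[of 0] by auto
  let ?f = "a 0 + b * g"
  have "?f div b = g" "?f mod b = a 0"
    using Suc.prems[of 0] b by (simp_all add: div_poly_less mod_poly_less)
  hence "(?f div b ^ i) mod b = a i" if "i < Suc l" for i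
    using that g by (cases i) (simp_all add: poly_div_mult_right)
  thus ?case by blast
qed simp

subsection \<open>Equidistribution of digital sequences\<close>

text \<open>Assumption \<open>shift\<close> asks only that agreement of leading digits survive
  translation, so digits may be encoded as integers although the encoding is not additive.\<close>

lemma digital_uniformly_distributed:
  fixes D :: "nat \<Rightarrow> 'p::prime_card mod_ring poly \<Rightarrow> nat \<Rightarrow> nat" and Q :: "nat \<Rightarrow> nat"
  assumes Q: "\<And>j. j < d \<Longrightarrow> Q j > 1"
    and D: "\<And>j f i. j < d \<Longrightarrow> D j f i < Q j"
    and shift: "\<And>j f g h l. j < d \<Longrightarrow> \<forall>i<l. D j f i = D j g i \<Longrightarrow>
      \<forall>i<l. D j (f + h) i = D j (g + h) i"
    and surj: "\<And>l e. (\<And>j i. j < d \<Longrightarrow> e j i < Q j) \<Longrightarrow> \<exists>f. \<forall>j<d. \<forall>i<l. D j f i = e j i"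
    and z: "\<And>n j. j < d \<Longrightarrow> z n j = (\<Sum>i. real (D j (nat_poly n) i) / real (Q j) ^ (i + 1))"
  shows "uniformly_distributed d z"
proof (rule uniformly_distributed_by_cells)
  fix m :: nat assume "m > 0"
  let ?p = "CARD('p)"
  define P where "P j = Q j ^ m" for j
  define U where "U f j = digit_val (Q j) (D j f) m" for f j
  define T where "T = PiE {..<d} (\<lambda>j. {..<P j})"
  have U_eq_iff: "U f j = U g j \<longleftrightarrow> (\<forall>i<m. D j f i = D j g i)" if "j < d" for f g j
    unfolding U_def by (rule digit_val_eq_iff) (rule D[OF that])+
  have U_less: "U f j < P j" if "j < d" for f j
    unfolding U_def P_def by (rule digit_val_less[OF D[OF that]])
  have U_shift: "U (f + h) j = U (g + h) j" if "j < d" "U f j = U g j" for f g h j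
    using that shift by (simp add: U_eq_iff)
  have "\<exists>f. \<forall>j<d. U f j = v j" if v: "v \<in> T" for v
  proof -
    have "\<exists>e. (\<forall>i. e i < Q j) \<and> digit_val (Q j) e m = v j" if "j < d" for j
      using v that Q[OF that] by (intro digit_val_surj) (auto simp: T_def P_def PiE_iff)
    hence "\<forall>j\<in>{..<d}. \<exists>e. (\<forall>i. e i < Q j) \<and> digit_val (Q j) e m = v j"
      by blast
    from bchoice[OF this] obtain e where e: "\<And>j i. j < d \<Longrightarrow> e j i < Q j"
        "\<And>j. j < d \<Longrightarrow> digit_val (Q j) (e j) m = v j"
      by blast
    have "\<exists>f. \<forall>j<d. \<forall>i<m. D j f i = e j i"
      by (rule surj) (rule e(1))
    then obtain f where f: "\<And>j i. j < d \<Longrightarrow> i < m \<Longrightarrow> D j f i = e j i"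
      by blast
    have "U f j = v j" if "j < d" for j
      unfolding U_def e(2)[OF that, symmetric]
      using that by (subst digit_val_eq_iff) (simp_all add: D e f)
    thus ?thesis by blast
  qed
  hence "\<forall>v\<in>T. \<exists>f. \<forall>j<d. U f j = v j" by blast
  then obtain rep where rep: "\<And>v j. v \<in> T \<Longrightarrow> j < d \<Longrightarrow> U (rep v) j = v j"
    by (auto dest!: bchoice)
  have finT: "finite T" unfolding T_def by (intro finite_PiE) auto
  \<comment> \<open>M exceeds the degree of every representative, so differences of representatives
    have degree less than M and translation by them preserves blocks.\<close>
  define M where "M = (\<Sum>v\<in>T. degree (rep v)) + 1"
  have deg_rep: "degree (rep v) < M" if "v \<in> T" for v
    using member_le_sum[OF that _ finT, of "\<lambda>v. degree (rep v)"] by (simp add: M_def)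
  define F where "F q v = {n. n div ?p ^ M = q \<and> (\<forall>j<d. U (nat_poly n) j = v j)}" for q v
  have C: "?p ^ M > 0" by simp
  have block: "{n. n div ?p ^ M = q} = {q * ?p ^ M..<q * ?p ^ M + ?p ^ M}" for q
  proof -
    have "n div ?p ^ M = q \<longleftrightarrow> q * ?p ^ M \<le> n \<and> n < q * ?p ^ M + ?p ^ M" for n
      using div_nat_eqI[of "?p ^ M" q n] div_times_less_eq_dividend[of n "?p ^ M"]
        dividend_less_div_times[OF C, of n] by (auto simp: mult.commute)
    thus ?thesis by (simp only: set_eq_iff mem_Collect_eq atLeastLessThan_iff simp_thms)
  qed
  have finF: "finite (F q v)" for q v
  proof (rule finite_subset)
    show "F q v \<subseteq> {n. n div ?p ^ M = q}" by (auto simp: F_def)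
    show "finite {n. n div ?p ^ M = q}" by (simp only: block finite_atLeastLessThan)
  qed
  have card_le: "card (F q v) \<le> card (F q v')" if v: "v \<in> T" "v' \<in> T" for q v v'
  proof (rule card_inj_on_le[OF _ _ finF])
    \<comment> \<open>Translation by \<open>?h\<close> carries the cell of v injectively into that
      of v' within the same block. Exchanging v and v' gives equal cardinalities.\<close>
    let ?h = "rep v' - rep v"
    let ?\<theta> = "\<lambda>n. poly_index (nat_poly n + ?h)"
    show "inj_on ?\<theta> (F q v)"
    proof (rule inj_onI)
      fix n n' assume "?\<theta> n = ?\<theta> n'"
      hence "nat_poly (?\<theta> n) = (nat_poly (?\<theta> n') :: 'p mod_ring poly)" by simp
      hence "(nat_poly n :: 'p mod_ring poly) = nat_poly n'" by simp
      thus "n = n'" by (metis poly_index_nat_poly)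
    qed
    show "?\<theta> ` F q v \<subseteq> F q v'"
    proof (rule image_subsetI)
      fix n assume n: "n \<in> F q v"
      have "Polynomial.coeff ?h (k + M) = 0" for k
        using deg_rep[OF v(1)] deg_rep[OF v(2)] by (simp add: Polynomial.coeff_eq_0)
      hence "?\<theta> n div ?p ^ M = q"
        using n by (simp add: F_def div_CARD_power_eq_iff)
      moreover have "U (nat_poly (?\<theta> n)) j = v' j" if "j < d" for j
      proof -
        have "U (nat_poly n) j = U (rep v) j"
          using n rep[OF v(1) that] that by (simp add: F_def)
        from U_shift[OF that this, of ?h] show ?thesis
          using rep[OF v(2) that] by simp
      qed
      ultimately show "?\<theta> n \<in> F q v'" by (simp add: F_def)
    qed
  qed
  have cardT: "card T = (\<Prod>j<d. P j)"
    by (simp add: T_def card_PiE)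
  have card_F: "card T * card (F q v) = ?p ^ M" if v: "v \<in> T" for q v
  proof -
    have "{n. n div ?p ^ M = q} = (\<Union>v'\<in>T. F q v')"
    proof -
      have "n \<in> F (n div ?p ^ M) (restrict (U (nat_poly n)) {..<d})"
        "restrict (U (nat_poly n)) {..<d} \<in> T" for n
        using U_less by (simp_all add: F_def T_def)
      hence "\<exists>v'\<in>T. n \<in> F (n div ?p ^ M) v'" for n by blast
      thus ?thesis by (auto simp: F_def)
    qed
    moreover have "card (\<Union>v'\<in>T. F q v') = (\<Sum>v'\<in>T. card (F q v'))"
    proof (rule card_UN_disjoint[OF finT])
      show "\<forall>w\<in>T. \<forall>w'\<in>T. w \<noteq> w' \<longrightarrow> F q w \<inter> F q w' = {}"
      proof (intro ballI impI, rule ccontr)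
        fix w w' assume w: "w \<in> T" "w' \<in> T" "w \<noteq> w'" "F q w \<inter> F q w' \<noteq> {}"
        from w(4) have "\<forall>j<d. w j = w' j" by (auto simp: F_def)
        with w show False by (auto simp: T_def intro: PiE_ext)
      qed
    qed (simp add: finF)
    moreover have "(\<Sum>v'\<in>T. card (F q v')) = (\<Sum>v'\<in>T. card (F q v))"
      using card_le v by (intro sum.cong refl antisym) auto
    ultimately have "card T * card (F q v) = card {n. n div ?p ^ M = q}"
      by simp
    thus ?thesis unfolding block by simp
  qed
  show "\<exists>P u. (\<forall>j<d. m \<le> P j) \<and>
      (\<forall>n. \<forall>j<d. u n j < P j \<and> real (u n j) / real (P j) \<le> z n j
         \<and> z n j \<le> (real (u n j) + 1) / real (P j)) \<and>
      (\<forall>v. (\<forall>j<d. v j < P j) \<longrightarrow>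
         (\<lambda>N. real (card {n. n < N \<and> (\<forall>j<d. u n j = v j)}) / real N)
           \<longlonglongrightarrow> 1 / (\<Prod>j<d. real (P j)))"
  proof (rule exI[of _ P], rule exI[of _ "\<lambda>n. U (nat_poly n)"], intro conjI allI impI)
    fix j assume "j < d"
    thus "m \<le> P j"
      using Q[of j] power_gt_expt[of "Q j" m] by (simp add: P_def)
  next
    fix n j assume j: "j < d"
    show "U (nat_poly n) j < P j"
      by (rule U_less[OF j])
    show "real (U (nat_poly n) j) / real (P j) \<le> z n j"
      "z n j \<le> (real (U (nat_poly n) j) + 1) / real (P j)"
      using digit_val_bounds[OF D[OF j] Q[OF j]] by (simp_all add: U_def P_def z[OF j])
  next
    fix v assume v: "\<forall>j<d. v j < P j"
    let ?v = "restrict v {..<d}"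
    have vT: "?v \<in> T" using v by (auto simp: T_def)
    have F_eq: "{n. n div ?p ^ M = q \<and> (\<forall>j<d. U (nat_poly n) j = v j)} = F q ?v" for q
      by (auto simp: F_def)
    have T0: "card T > 0" using vT finT by (auto simp: card_gt_0_iff)
    \<comment> \<open>By \<open>card_F\<close> the count per block is the same for every q. Its
      product with card T is p^M > 0, so K is nonzero and cancels in the limit, leaving 1 / card
      T.\<close>
    define K where "K = ?p ^ M div card T"
    have KF: "card (F q ?v) = K" for q
      unfolding K_def card_F[OF vT, of q, symmetric] using T0 by simp
    have "(\<lambda>N. real (card {n. n < N \<and> (\<forall>j<d. U (nat_poly n) j = v j)}) / real N)
           \<longlonglongrightarrow> real K / real (?p ^ M)"
      using KF by (intro tendsto_density_of_block_count[OF C]) (simp add: F_eq)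
    also have "real (?p ^ M) = real (card T) * real K"
      using card_F[OF vT, of 0] KF[of 0] by (metis of_nat_mult)
    also have "real K / (real (card T) * real K) = 1 / (\<Prod>j<d. real (P j))"
    proof -
      have "K > 0" using card_F[OF vT, of 0] KF[of 0] C by (metis gr0I mult_0_right nat_less_le)
      thus ?thesis by (simp add: cardT)
    qed
    finally show "(\<lambda>N. real (card {n. n < N \<and> (\<forall>j<d. U (nat_poly n) j = v j)}) / real N)
           \<longlonglongrightarrow> 1 / (\<Prod>j<d. real (P j))" .
  qed
qed

section \<open>The hybrid sequence\<close>

text \<open>The base depends on the coordinate: Kronecker digits are in base p, while a van der
  Corput digit is a whole remainder modulo b, read as a digit in base p^(degree b).\<close>

definition hybrid_digit :: "nat \<Rightarrow> (nat \<Rightarrow> int \<Rightarrow> 'p::prime_card mod_ring) \<Rightarrow>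
    (nat \<Rightarrow> 'p mod_ring poly) \<Rightarrow> nat \<Rightarrow> 'p mod_ring poly \<Rightarrow> nat \<Rightarrow> nat" where
  "hybrid_digit s L b j f i =
     (if j < s then digit (poly_times_laurent f (L j) (int i + 1))
      else poly_index ((f div b (j - s) ^ i) mod b (j - s)))"

lemma digit_eq_iff: "digit c = digit c' \<longleftrightarrow> c = (c' :: 'p::prime_card mod_ring)"
  by (metis of_nat_digit)

lemma poly_index_eq_iff: "poly_index f = poly_index g \<longleftrightarrow> f = (g :: 'p::prime_card mod_ring poly)"
  by (metis nat_poly_poly_index)

lemma hybrid_digit_shift:
  assumes "\<And>j. j < t \<Longrightarrow> b j \<noteq> 0" "j < s + t"
    and "\<forall>i<l. hybrid_digit s L b j f i = hybrid_digit s L b j g i"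
  shows "\<forall>i<l. hybrid_digit s L b j (f + h) i = hybrid_digit s L b j (g + h) i"
proof (cases "j < s")
  case True
  thus ?thesis
    using assms(3) by (simp add: hybrid_digit_def digit_eq_iff poly_times_laurent_add)
next
  case False
  hence b: "b (j - s) \<noteq> 0" using assms(1,2) by simp
  have "f mod b (j - s) ^ l = g mod b (j - s) ^ l"
    using assms(3) False
    by (simp add: hybrid_digit_def poly_index_eq_iff poly_base_expansion_eq_iff[OF b])
  hence "(f + h) mod b (j - s) ^ l = (g + h) mod b (j - s) ^ l"
    by (rule mod_add_cong) simp
  thus ?thesis
    using False by (simp add: hybrid_digit_def poly_index_eq_iff poly_base_expansion_eq_iff[OF b])
qed

lemma hybrid_digits_exist:
  fixes L :: "nat \<Rightarrow> int \<Rightarrow> 'p::prime_card mod_ring" and b :: "nat \<Rightarrow> 'p mod_ring poly"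
  assumes laurent: "\<And>j. j < s \<Longrightarrow> is_laurent (L j)" and indep: "lin_indep_1_laurent s L"
    and b: "\<And>j. j < t \<Longrightarrow> degree (b j) > 0"
    and coprime: "\<And>i j. i < t \<Longrightarrow> j < t \<Longrightarrow> i \<noteq> j \<Longrightarrow> coprime (b i) (b j)"
    and e: "\<And>j i. j < s \<Longrightarrow> e j i < CARD('p)"
      "\<And>j i. j < t \<Longrightarrow> e (s + j) i < CARD('p) ^ degree (b j)"
  shows "\<exists>f. \<forall>j<s + t. \<forall>i<l. hybrid_digit s L b j f i = e j i"
proof -
  \<comment> \<open>\<open>nat_poly\<close> decodes the prescribed integers into remainders; the
    bound in \<open>e\<close> makes their degree less than that of b j.\<close>
  have "\<forall>j\<in>{..<t}. \<exists>r. \<forall>i<l. (r div b j ^ i) mod b j = nat_poly (e (s + j) i)"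
    by (intro ballI poly_base_expansion_exists, rule degree_nat_poly_less) (auto intro: e(2) b)
  from bchoice[OF this] obtain r where
    r: "\<And>j i. j < t \<Longrightarrow> i < l \<Longrightarrow> (r j div b j ^ i) mod b j = nat_poly (e (s + j) i)"
    by blast
  have "\<exists>R. \<forall>j\<in>{..<t}. [R = r j] (mod b j ^ l)"
    by (rule chinese_remainder_poly) (use coprime in \<open>auto simp: coprime_power_left_iff coprime_power_right_iff\<close>)
  then obtain R where R: "\<And>j. j < t \<Longrightarrow> R mod b j ^ l = r j mod b j ^ l"
    by (auto simp: cong_def)
  \<comment> \<open>Each b j ^ l divides B, so adding k * B to R keeps the Halton digits whatever k
    is.\<close>
  define B where "B = (\<Prod>j<t. b j ^ l)"
  have b0: "b j \<noteq> 0" if "j < t" for j using b[OF that] by auto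
  hence "B \<noteq> 0" by (auto simp: B_def)
  \<comment> \<open>The target for k * B is the wanted digit minus the contribution of R, as
    elements of F_p.\<close>
  then obtain k where k: "\<And>j i. j < s \<Longrightarrow> i < l \<Longrightarrow> poly_times_laurent (k * B) (L j) (int i + 1) =
      of_nat (e j i) - poly_times_laurent R (L j) (int i + 1)"
    using fractional_digits_interpolate[OF laurent indep, where B = B and m = l and
      \<tau> = "\<lambda>j i. of_nat (e j i) - poly_times_laurent R (L j) (int i + 1)"] by blast
  let ?f = "R + k * B"
  have "hybrid_digit s L b j ?f i = e j i" if "j < s + t" "i < l" for j i
  proof (cases "j < s")
    case True
    thus ?thesis
      using that e by (simp add: hybrid_digit_def poly_times_laurent_add k digit_of_nat)
  next
    case False
    define j' where "j' = j - s"
    have j: "j = s + j'" "j' < t" using False that by (simp_all add: j'_def)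
    have "b j' ^ l dvd B" unfolding B_def using j by (intro dvd_prodI) auto
    hence "?f mod b j' ^ l = r j' mod b j' ^ l"
      using R[OF j(2)] by (metis add_diff_cancel_left' dvd_mult mod_eq_dvd_iff)
    hence "(?f div b j' ^ i) mod b j' = nat_poly (e (s + j') i)"
      using poly_base_expansion_eq_iff[OF b0[OF j(2)], of l ?f "r j'"] r[OF j(2)] that by simp
    thus ?thesis using j by (simp add: hybrid_digit_def)
  qed
  thus ?thesis by blast
qed

theorem theorem1:
  fixes s t :: nat
    and L :: "nat \<Rightarrow> int \<Rightarrow> 'p::prime_card mod_ring"
    and b :: "nat \<Rightarrow> 'p mod_ring poly"
  assumes "\<forall>j<s. is_laurent (L j)"
    and "\<forall>j<t. monic (b j) \<and> degree (b j) \<ge> 1"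
    and "\<forall>i<t. \<forall>j<t. i \<noteq> j \<longrightarrow> coprime (b i) (b j)"
    and "lin_indep_1_laurent s L"
  shows "uniformly_distributed (s + t) (hybrid_pt s L b)"
proof -
  define Q where "Q j = (if j < s then CARD('p) else CARD('p) ^ degree (b (j - s)))" for j
  have b: "degree (b j) > 0" if "j < t" for j
  proof -
    have "degree (b j) \<ge> 1" by (rule assms(2)[THEN spec, THEN mp, OF that, THEN conjunct2])
    thus ?thesis by linarith
  qed
  have b0: "b j \<noteq> 0" if "j < t" for j using b[OF that] by auto
  show ?thesis
  proof (rule digital_uniformly_distributed[where D = "hybrid_digit s L b" and Q = Q])
    fix j assume "j < s + t"
    thus "Q j > 1"
      using b[of "j - s"] by (auto simp: Q_def CARD_prime_card_gt_1 simp del: One_nat_def intro!: one_less_power)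
  next
    fix j i and f :: "'p mod_ring poly" assume j: "j < s + t"
    show "hybrid_digit s L b j f i < Q j"
    proof (cases "j < s")
      case False
      \<comment> \<open>If the remainder is 0, its degree is 0 and the inequality comes from degree
        (b (j - s)) > 0.\<close>
      with j have "degree ((f div b (j - s) ^ i) mod b (j - s)) < degree (b (j - s))"
        using degree_mod_less'[OF b0, of "j - s"] b[of "j - s"]
        by (cases "(f div b (j - s) ^ i) mod b (j - s) = 0") auto
      hence "poly_index ((f div b (j - s) ^ i) mod b (j - s)) < CARD('p) ^ degree (b (j - s))"
        by (intro poly_index_less_power) (simp add: Polynomial.coeff_eq_0)
      thus ?thesis using False by (simp add: hybrid_digit_def Q_def)
    qed (simp add: hybrid_digit_def Q_def digit_less)
  next
    fix j l and f g h :: "'p mod_ring poly"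
    assume "j < s + t" "\<forall>i<l. hybrid_digit s L b j f i = hybrid_digit s L b j g i"
    thus "\<forall>i<l. hybrid_digit s L b j (f + h) i = hybrid_digit s L b j (g + h) i"
      by (intro hybrid_digit_shift[where t = t] b0)
  next
    fix l and e :: "nat \<Rightarrow> nat \<Rightarrow> nat"
    assume e: "\<And>j i. j < s + t \<Longrightarrow> e j i < Q j"
    show "\<exists>f. \<forall>j<s + t. \<forall>i<l. hybrid_digit s L b j f i = e j i"
    proof (rule hybrid_digits_exist)
      show "e j i < CARD('p)" if "j < s" for j i
        using e[of j i] that by (simp add: Q_def)
      show "e (s + j) i < CARD('p) ^ degree (b j)" if "j < t" for j i
        using e[of "s + j" i] that by (simp add: Q_def)
    qed (use assms b in auto)
  next
    fix n j assume "j < s + t"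
    show "hybrid_pt s L b n j =
        (\<Sum>i. real (hybrid_digit s L b j (nat_poly n) i) / real (Q j) ^ (i + 1))"
      by (simp add: hybrid_pt_def kronecker_pt_def vdc_pt_def hybrid_digit_def Q_def fp_val_def
          eval_at_p_eq_poly_index to_int_mod_ring_bounds power_mult power_add)
  qed
qed

end
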